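(* Let $d\ge 2$ and $m,n\ge 1$ be integers with $m+n=d$. The following two assertions are equivalent. (A) For every $(m,n)$-weight vector $\omega$, every $k\in\{1,\dots,d-1\}$ and every unimodular lattice $\Lambda\subset\mathbb{R}^d$: if for every $k$-dimensional linear subspace $W\subset\mathbb{R}^d$ spanned by vectors of $\Lambda$ there is some $I\subset\{1,\dots,d\}$ of cardinality $k$ such that $\mu_I>0$ and $\pi_I(W)=\mathbb{R}^I$, then $\boldsymbol{L}^{\omega}(\Lambda,\cdot)$ is connected at $k$. (B) For every $(m,n)$-weight vector $\omega$, every $k\in\{1,\dots,d-1\}$ and every unimodular lattice $\Lambda\subset\mathbb{R}^d$: if for every $k$-dimensional linear subspace $W\subset\mathbb{R}^d$ spanned by vectors of $\Lambda$ the largest eigenvalue in the decomposition of $v_W$ into eigenvectors of $a^{\omega}_1$ in $\bigwedge^k\mathbb{R}^d$ is strictly greater than $1$, then $\boldsymbol{L}^{\omega}(\Lambda,\cdot)$ is connected at $k$.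
   Context: A vector $\omega=(\omega_1,\dots,\omega_d)\in\mathbb{R}^d$ is an $(m,n)$-weight vector if $\omega_1\ge\cdots\ge\omega_m>0$, $\omega_{m+1}\ge\cdots\ge\omega_d>0$ and $\sum_{i=1}^m\omega_i=\sum_{j=m+1}^d\omega_j=1$. For $t\in\mathbb{R}$ put $a^{\omega}_t=\mathrm{diag}(e^{\omega_1 t},\dots,e^{\omega_m t},e^{-\omega_{m+1}t},\dots,e^{-\omega_d t})\in \mathrm{SL}_d(\mathbb{R})$. For $I\subset\{1,\dots,d\}$, $\mu_I=\sum_{i\in I,\,i\le m}\omega_i-\sum_{i\in I,\,i\ge m+1}\omega_i$; $\mathbb{R}^I$ is the linear span of $\{e_i:i\in I\}$, with $e_i$ the standard basis vectors of $\mathbb{R}^d$; and $\pi_I:\mathbb{R}^d\to\mathbb{R}^I$ is the orthogonal projection. A unimodular lattice is a lattice in $\mathbb{R}^d$ of covolume $1$. Let $\mathcal{C}$ be the closed unit cube of $\mathbb{R}^d$ centered at $0$ (its side length is immaterial below: rescaling $\mathcal{C}$ adds the same constant to all $L_i^\omega$). For a unimodular lattice $\Lambda$, $t\ge 0$ and $1\le i\le d$, $\lambda_i(a^{\omega}_t\Lambda)$ is the least $\lambda>0$ such that $\lambda\mathcal{C}$ contains $i$ linearly independent vectors of $a^{\omega}_t\Lambda$. Set $L^{\omega}_i(\Lambda,t)=\log\lambda_i(a^{\omega}_t\Lambda)$ and $\boldsymbol{L}^{\omega}(\Lambda,t)=(L^{\omega}_1(\Lambda,t),\dots,L^{\omega}_d(\Lambda,t))$.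 For $k\in\{1,\dots,d-1\}$, $\boldsymbol{L}^{\omega}(\Lambda,\cdot)$ is connected at $k$ if the set $\{t\ge 0: L^{\omega}_k(\Lambda,t)=L^{\omega}_{k+1}(\Lambda,t)\}$ is unbounded above. For a $k$-dimensional subspace $W$ with basis $w_1,\dots,w_k$, $v_W=w_1\wedge\cdots\wedge w_k\in\bigwedge^k\mathbb{R}^d$ (well defined up to a nonzero scalar). The group $\mathrm{SL}_d(\mathbb{R})$ acts on $\bigwedge^k\mathbb{R}^d$ by $g(v_1\wedge\cdots\wedge v_k)=gv_1\wedge\cdots\wedge gv_k$. Since $a^{\omega}_1$ acts diagonalizably on $\bigwedge^k\mathbb{R}^d$, every vector $v$ is uniquely a sum of its components in the distinct eigenspaces of $a_1^\omega$; "the largest eigenvalue in the decomposition of $v$ into eigenvectors of $a^\omega_1$" is the largest eigenvalue of $a_1^\omega$ whose eigenspace component of $v$ is nonzero. *)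

theory Defs
  imports "Jordan_Normal_Form.Determinant" "HOL-Analysis.Analysis"
begin

no_notation Matrix.vec_index (infixl \<open>$\<close> 100)

text \<open>The space \<open>\<real>\<^sup>d\<close> is \<open>real ^ 'd\<close> for a finite linearly ordered index type \<open>'d\<close> with
  \<open>CARD('d) = d\<close>; the order identifies \<open>'d\<close> with \<open>{1, \<dots>, d}\<close> through \<open>pos\<close>.\<close>

definition pos :: "'d::{finite,linorder} \<Rightarrow> nat" where
  "pos i = card {j. j \<le> i}"

lemma bij_betw_pos: "bij_betw (pos :: 'd::{finite,linorder} \<Rightarrow> nat) UNIV {1..CARD('d)}"
proof -
  have mono: "pos i < pos j" if "i < j" for i j :: 'd
    proof -
    have "j \<in> {l. l \<le> j}" "j \<notin> {l. l \<le> i}" using that by auto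
    moreover have "{l. l \<le> i} \<subseteq> {l. l \<le> j}" using that by auto
    ultimately show ?thesis unfolding pos_def by (intro psubset_card_mono) auto
  qed
  then have inj: "inj (pos :: 'd \<Rightarrow> nat)"
    by (metis injI less_irrefl linorder_neqE)
  have "pos i \<in> {1..CARD('d)}" for i :: 'd
    unfolding pos_def by (auto simp: Suc_le_eq card_gt_0_iff intro: card_mono)
  then have "pos ` (UNIV :: 'd set) = {1..CARD('d)}"
    using inj by (intro card_subset_eq) (auto simp: card_image)
  with inj show ?thesis by (simp add: bij_betw_def)
qed

subsection \<open>Weights and the diagonal flow\<close>

definition weight_vector :: "nat \<Rightarrow> nat \<Rightarrow> real ^ 'd::{finite,linorder} \<Rightarrow> bool" where
  "weight_vector m n \<omega> \<longleftrightarrow>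
     m + n = CARD('d) \<and>
     (\<forall>i. \<omega> $ i > 0) \<and>
     (\<forall>i j. i \<le> j \<and> pos j \<le> m \<longrightarrow> \<omega> $ j \<le> \<omega> $ i) \<and>
     (\<forall>i j. m < pos i \<and> i \<le> j \<longrightarrow> \<omega> $ j \<le> \<omega> $ i) \<and>
     (\<Sum>i | pos i \<le> m. \<omega> $ i) = 1 \<and>
     (\<Sum>i | m < pos i. \<omega> $ i) = 1"

definition flow :: "nat \<Rightarrow> real ^ 'd::{finite,linorder} \<Rightarrow> real \<Rightarrow>
    real ^ 'd::{finite,linorder} ^ 'd::{finite,linorder}" where
  "flow m \<omega> t =
     (\<chi> i j. if i = j then (if pos i \<le> m then exp (\<omega> $ i * t) else exp (- \<omega> $ i * t)) else 0)"

definition mu :: "nat \<Rightarrow> real ^ 'd::{finite,linorder} \<Rightarrow> 'd::{finite,linorder} set \<Rightarrow> real" where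
  "mu m \<omega> I = (\<Sum>i \<in> {i\<in>I. pos i \<le> m}. \<omega> $ i) - (\<Sum>i \<in> {i\<in>I. m < pos i}. \<omega> $ i)"

subsection \<open>Coordinate subspaces and orthogonal projections\<close>

definition coord_subspace :: "'d::finite set \<Rightarrow> (real ^ 'd::finite) set" where
  "coord_subspace I = span ((\<lambda>i. axis i 1) ` I)"

definition orth_proj :: "'a::euclidean_space set \<Rightarrow> 'a \<Rightarrow> 'a" where
  "orth_proj S x = (THE y. y \<in> S \<and> (\<forall>z\<in>S. orthogonal (x - y) z))"

lemma orth_proj_coord_subspace:
  "orth_proj (coord_subspace I) x = (\<chi> i. if i \<in> I then x $ i else 0)"
proof -
  let ?y = "(\<chi> i. if i \<in> I then x $ i else 0) :: real ^ 'a"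
  have S: "coord_subspace I = {z. \<forall>i. i \<notin> I \<longrightarrow> z $ i = 0}" (is "_ = ?R")
  proof
    have "subspace ?R" by (auto simp: subspace_def)
    then show "coord_subspace I \<subseteq> ?R"
      unfolding coord_subspace_def by (intro span_minimal) (auto simp: axis_def)
    show "?R \<subseteq> coord_subspace I"
    proof
      fix z assume z: "z \<in> ?R"
      have "z = (\<Sum>i\<in>UNIV. z $ i *s axis i 1)" by (simp add: basis_expansion)
      also have "\<dots> = (\<Sum>i\<in>I. z $ i *\<^sub>R axis i 1)"
        using z by (intro sum.mono_neutral_cong_right) (auto simp: scalar_mult_eq_scaleR)
      also have "\<dots> \<in> coord_subspace I"
        unfolding coord_subspace_def by (intro span_sum span_scale span_base) auto
      finally show "z \<in> coord_subspace I" .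
    qed
  qed
  show ?thesis unfolding orth_proj_def
  proof (rule the_equality)
    show "?y \<in> coord_subspace I \<and> (\<forall>z\<in>coord_subspace I. orthogonal (x - ?y) z)"
      unfolding S orthogonal_def inner_vec_def by (auto intro!: sum.neutral)
  next
    fix y assume y: "y \<in> coord_subspace I \<and> (\<forall>z\<in>coord_subspace I. orthogonal (x - y) z)"
    have "y $ i = x $ i" if "i \<in> I" for i
    proof -
      have "axis i 1 \<in> coord_subspace I" using that unfolding S by (auto simp: axis_def)
      with y have "orthogonal (x - y) (axis i 1)" by blast
      then show ?thesis by (simp add: orthogonal_def inner_axis)
    qed
    with y show "y = ?y" unfolding S by (auto simp: vec_eq_iff)
  qed
qed

subsection \<open>Unimodular lattices and successive minima\<close>

definition unimodular_lattice :: "(real ^ 'd::finite) set \<Rightarrow> bool" where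
  "unimodular_lattice \<Lambda> \<longleftrightarrow>
     (\<exists>g :: real ^ 'd ^ 'd. \<bar>Determinants.det g\<bar> = 1 \<and> \<Lambda> = {g *v z | z. \<forall>i. z $ i \<in> \<int>})"

definition unit_cube :: "(real ^ 'd::finite) set" where
  "unit_cube = {x. \<forall>i. \<bar>x $ i\<bar> \<le> 1 / 2}"

definition succ_min :: "nat \<Rightarrow> (real ^ 'd::finite) set \<Rightarrow> real" where
  "succ_min i \<Lambda> =
     (LEAST r. 0 < r \<and> (\<exists>S \<subseteq> \<Lambda> \<inter> (\<lambda>x. r *\<^sub>R x) ` unit_cube. independent S \<and> card S = i))"

definition log_min ::
  "nat \<Rightarrow> real ^ 'd::{finite,linorder} \<Rightarrow> nat \<Rightarrow> (real ^ 'd::{finite,linorder}) set \<Rightarrow> real \<Rightarrow> real" where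
  "log_min m \<omega> i \<Lambda> t = ln (succ_min i ((\<lambda>x. flow m \<omega> t *v x) ` \<Lambda>))"

definition connected_at ::
  "nat \<Rightarrow> real ^ 'd::{finite,linorder} \<Rightarrow> (real ^ 'd::{finite,linorder}) set \<Rightarrow> nat \<Rightarrow> bool" where
  "connected_at m \<omega> \<Lambda> k \<longleftrightarrow> \<not> bdd_above {t. 0 \<le> t \<and> log_min m \<omega> k \<Lambda> t = log_min m \<omega> (k + 1) \<Lambda> t}"

definition lattice_subspace :: "(real ^ 'd::finite) set \<Rightarrow> nat \<Rightarrow> (real ^ 'd::finite) set \<Rightarrow> bool" where
  "lattice_subspace \<Lambda> k W \<longleftrightarrow> dim W = k \<and> (\<exists>S\<subseteq>\<Lambda>. span S = W)"

subsection \<open>Exterior powers\<close>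

text \<open>The exterior algebra of \<open>\<real>\<^sup>d\<close> is \<open>real ^ ('d set)\<close>: its standard basis vector at
  \<open>I = {i\<^sub>1 < \<dots> < i\<^sub>k}\<close> stands for \<open>e\<^bsub>i\<^sub>1\<^esub> \<and> \<dots> \<and> e\<^bsub>i\<^sub>k\<^esub>\<close>, and the \<open>k\<close>-th exterior power consists of
  the vectors supported on the sets of cardinality \<open>k\<close>. Accordingly the coordinate of
  \<open>w\<^sub>1 \<and> \<dots> \<and> w\<^sub>k\<close> at \<open>I\<close> is the minor on the columns \<open>I\<close> of the matrix with rows \<open>w\<^sub>1, \<dots>, w\<^sub>k\<close>.\<close>

definition ext_power :: "nat \<Rightarrow> (real ^ ('d::finite set)) set" where
  "ext_power k = {v. \<forall>I. card I \<noteq> k \<longrightarrow> v $ I = 0}"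

definition wedge :: "(real ^ 'd::{finite,linorder}) list \<Rightarrow> real ^ ('d::{finite,linorder} set)" where
  "wedge ws = (\<chi> I. if card I = length ws
     then Determinant.det (Matrix.mat (length ws) (length ws)
            (\<lambda>(i, j). (ws ! i) $ (sorted_list_of_set I ! j)))
     else 0)"

text \<open>The action of a matrix on the exterior algebra, given on the standard basis by
  \<open>g (e\<^bsub>i\<^sub>1\<^esub> \<and> \<dots> \<and> e\<^bsub>i\<^sub>k\<^esub>) = g e\<^bsub>i\<^sub>1\<^esub> \<and> \<dots> \<and> g e\<^bsub>i\<^sub>k\<^esub>\<close> and extended linearly. The lemma
  \<open>ext_map_wedge\<close> below shows that it satisfies this rule on all decomposable vectors.\<close>

definition ext_map ::
  "real ^ 'd::{finite,linorder} ^ 'd::{finite,linorder} \<Rightarrow>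
   real ^ ('d::{finite,linorder} set) \<Rightarrow> real ^ ('d::{finite,linorder} set)" where
  "ext_map g v = (\<Sum>J\<in>UNIV. v $ J *\<^sub>R wedge (map (\<lambda>j. g *v axis j 1) (sorted_list_of_set J)))"

lemma sum_subsets_permutations:
  fixes F :: "(nat \<Rightarrow> 'd::{finite,linorder}) \<Rightarrow> real"
  shows "(\<Sum>f | f \<in> {0..<k} \<rightarrow>\<^sub>E UNIV \<and> inj_on f {0..<k}. F f) =
    (\<Sum>J | card J = k. \<Sum>p | p permutes {0..<k}.
       F (restrict (\<lambda>i. sorted_list_of_set J ! p i) {0..<k}))"
proof -
  let ?K = "{0..<k}"
  let ?s = "\<lambda>J :: 'd set. (\<lambda>i. sorted_list_of_set J ! i)"
  let ?S = "SIGMA J : {J :: 'd set. card J = k}. {p. p permutes ?K}"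
  let ?h = "\<lambda>(J, p). restrict (\<lambda>i. ?s J (p i)) ?K"
  have s: "bij_betw (?s J) ?K J" if "card J = k" for J
    using that by (intro bij_betw_nth) auto
  have comp: "bij_betw (\<lambda>i. ?s J (p i)) ?K J" if "card J = k" "p permutes ?K" for J p
    using bij_betw_trans[OF permutes_imp_bij[OF that(2)] s[OF that(1)]] by (simp add: o_def)
  have "bij_betw ?h ?S {f. f \<in> ?K \<rightarrow>\<^sub>E UNIV \<and> inj_on f ?K}"
    unfolding bij_betw_def
  proof
    show "inj_on ?h ?S"
    proof (rule inj_onI)
      fix x y assume xy: "x \<in> ?S" "y \<in> ?S" "?h x = ?h y"
      obtain J p J' p' where [simp]: "x = (J, p)" "y = (J', p')" by (metis surj_pair)
      have J: "card J = k" "card J' = k" and p: "p permutes ?K" "p' permutes ?K"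
        and eq: "restrict (\<lambda>i. ?s J (p i)) ?K = restrict (\<lambda>i. ?s J' (p' i)) ?K"
        using xy by simp_all
      from eq have eq': "?s J (p i) = ?s J' (p' i)" if "i \<in> ?K" for i
        using that by (metis (no_types, lifting) restrict_apply')
      have "J = (\<lambda>i. ?s J (p i)) ` ?K" "J' = (\<lambda>i. ?s J' (p' i)) ` ?K"
        using comp J p by (simp_all add: bij_betw_def)
      then have JJ: "J = J'" using image_cong[OF refl eq', of ?K] by simp
      have "p i = p' i" for i
      proof (cases "i \<in> ?K")
        case True
        then have "p i \<in> ?K" "p' i \<in> ?K"
          using permutes_in_image[OF p(1)] permutes_in_image[OF p(2)] by blast+
        with eq'[OF True] JJ show ?thesis
          using inj_onD[OF bij_betw_imp_inj_on[OF s[OF J(1)]], of "p i" "p' i"] by simp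
      next
        case False
        then show ?thesis using permutes_not_in[OF p(1)] permutes_not_in[OF p(2)] by simp
      qed
      with JJ show "x = y" by (simp add: fun_eq_iff)
    qed
    show "?h ` ?S = {f. f \<in> ?K \<rightarrow>\<^sub>E UNIV \<and> inj_on f ?K}"
    proof
      show "?h ` ?S \<subseteq> {f. f \<in> ?K \<rightarrow>\<^sub>E UNIV \<and> inj_on f ?K}"
      proof (rule image_subsetI)
        fix x assume "x \<in> ?S"
        then obtain J p where x: "x = (J, p)" "card J = k" "p permutes ?K" by blast
        then have "inj_on (\<lambda>i. ?s J (p i)) ?K" using comp by (simp add: bij_betw_def)
        then show "?h x \<in> {f. f \<in> ?K \<rightarrow>\<^sub>E UNIV \<and> inj_on f ?K}"
          by (simp add: x inj_on_def)
      qed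
      show "{f. f \<in> ?K \<rightarrow>\<^sub>E UNIV \<and> inj_on f ?K} \<subseteq> ?h ` ?S"
      proof
        fix f :: "nat \<Rightarrow> 'd" assume "f \<in> {f. f \<in> ?K \<rightarrow>\<^sub>E UNIV \<and> inj_on f ?K}"
        then have f: "f \<in> ?K \<rightarrow>\<^sub>E UNIV" and inj: "inj_on f ?K" by auto
        define J where "J = f ` ?K"
        have J: "card J = k" using inj by (simp add: J_def card_image)
        have fb: "bij_betw f ?K J" using inj by (simp add: J_def bij_betw_def)
        define q where "q = (\<lambda>i. inv_into ?K (?s J) (f i))"
        have qb: "bij_betw q ?K ?K"
          using bij_betw_trans[OF fb bij_betw_inv_into[OF s[OF J]]] by (simp add: q_def o_def)
        define p where "p = (\<lambda>i. if i \<in> ?K then q i else i)"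
        have "bij_betw p ?K ?K" using qb by (subst bij_betw_cong[of _ _ q]) (auto simp: p_def)
        then have pp: "p permutes ?K" by (rule bij_imp_permutes) (auto simp: p_def)
        have "f i = restrict (\<lambda>i. ?s J (p i)) ?K i" for i
        proof (cases "i \<in> ?K")
          case True
          then have "f i \<in> ?s J ` ?K" using s[OF J] unfolding bij_betw_def J_def by blast
          then show ?thesis using True by (simp add: p_def q_def f_inv_into_f)
        next
          case False
          then show ?thesis using f by (simp add: PiE_def extensional_def)
        qed
        then have "f = restrict (\<lambda>i. ?s J (p i)) ?K" by (rule ext)
        then have "f = ?h (J, p)" by (simp only: prod.case)
        moreover have "(J, p) \<in> ?S" using J pp by simp
        ultimately show "f \<in> ?h ` ?S" by (rule image_eqI)
      qed
    qed
  qed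
  then have "(\<Sum>f | f \<in> ?K \<rightarrow>\<^sub>E UNIV \<and> inj_on f ?K. F f) = (\<Sum>x\<in>?S. F (?h x))"
    by (rule sum.reindex_bij_betw[symmetric])
  also have "\<dots> = (\<Sum>J | card J = k. \<Sum>p | p permutes ?K. F (?h (J, p)))"
    by (subst sum.Sigma) (auto simp: finite_permutations split_def)
  finally show ?thesis by simp
qed

lemma det_mat_eq:
  "Determinant.det (Matrix.mat k k (\<lambda>(i, j). h i j)) =
    (\<Sum>p | p permutes {0..<k}. signof p * (\<Prod>i\<in>{0..<k}. (h i (p i) :: real)))"
proof -
  have "(\<Prod>i\<in>{0..<k}. Matrix.mat k k (\<lambda>(i, j). h i j) $$ (i, p i)) = (\<Prod>i\<in>{0..<k}. h i (p i))"
    if p: "p permutes {0..<k}" for p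
  proof (rule prod.cong[OF refl])
    fix i assume i: "i \<in> {0..<k}"
    then have "p i \<in> {0..<k}" using permutes_in_image[OF p] by blast
    with i show "Matrix.mat k k (\<lambda>(i, j). h i j) $$ (i, p i) = h i (p i)" by simp
  qed
  then show ?thesis by (subst det_def'[where n = k]) simp_all
qed

lemma ext_map_wedge: "ext_map g (wedge ws) = wedge (map (\<lambda>w. g *v w) ws)"
proof (rule vec_eq_iff[THEN iffD2], rule allI)
  fix I :: "'a set"
  define k where "k = length ws"
  let ?K = "{0..<k}"
  let ?s = "\<lambda>J :: 'a set. (\<lambda>i. sorted_list_of_set J ! i)"
  let ?W = "\<lambda>J. Determinant.det (Matrix.mat k k (\<lambda>(i, j). (ws ! i) $ ?s J j))"
  let ?G = "\<lambda>f. Determinant.det (Matrix.mat k k (\<lambda>(i, j). g $ ?s I j $ f i))"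
  show "ext_map g (wedge ws) $ I = wedge (map (\<lambda>w. g *v w) ws) $ I"
  proof (cases "card I = k")
    case False
    then show ?thesis
      by (auto simp: ext_map_def wedge_def k_def intro!: sum.neutral)
  next
    case True
    have col: "(g *v axis j 1) $ i = g $ i $ j" for i j
      by (simp add: matrix_vector_mult_basis column_def)
    have "ext_map g (wedge ws) $ I = (\<Sum>J | card J = k. ?W J * ?G (?s J))"
    proof -
      have "ext_map g (wedge ws) $ I = (\<Sum>J\<in>UNIV. if card J = k then ?W J * ?G (?s J) else 0)"
        unfolding ext_map_def sum_component
      proof (rule sum.cong[OF refl])
        fix J :: "'a set"
        have "Matrix.mat k k (\<lambda>(i, j). (map (\<lambda>j. g *v axis j 1) (sorted_list_of_set J) ! i) $ ?s I j)
            = Matrix.mat k k (\<lambda>(i, j). g $ ?s I j $ ?s J i)" if "card J = k"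
          using that by (intro eq_matI) (auto simp: col)
        then show "(wedge ws $ J *\<^sub>R wedge (map (\<lambda>j. g *v axis j 1) (sorted_list_of_set J))) $ I
            = (if card J = k then ?W J * ?G (?s J) else 0)"
          using True by (auto simp: wedge_def k_def)
      qed
      then show ?thesis by (simp add: sum.If_cases)
    qed
    also have "\<dots> = (\<Sum>J | card J = k. \<Sum>p | p permutes ?K.
        (\<Prod>i\<in>?K. (ws ! i) $ ?s J (p i)) * ?G (\<lambda>i. ?s J (p i)))"
    proof (rule sum.cong[OF refl])
      fix J :: "'a set"
      have "?G (\<lambda>i. ?s J (p i)) = signof p * ?G (?s J)" if p: "p permutes ?K" for p
      proof -
        have "Matrix.mat k k (\<lambda>(i, j). g $ ?s I j $ ?s J (p i)) =
          Matrix.mat k k (\<lambda>(i, j). Matrix.mat k k (\<lambda>(i, j). g $ ?s I j $ ?s J i) $$ (p i, j))"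
          using permutes_in_image[OF p] by (intro eq_matI) auto
        also have "Determinant.det \<dots> =
          signof p * Determinant.det (Matrix.mat k k (\<lambda>(i, j). g $ ?s I j $ ?s J i))"
          by (rule Determinant.det_permute_rows[OF _ p]) simp
        finally show ?thesis .
      qed
      moreover have "?W J = (\<Sum>p | p permutes ?K. signof p * (\<Prod>i\<in>?K. (ws ! i) $ ?s J (p i)))"
        by (rule det_mat_eq)
      ultimately show "?W J * ?G (?s J) = (\<Sum>p | p permutes ?K.
        (\<Prod>i\<in>?K. (ws ! i) $ ?s J (p i)) * ?G (\<lambda>i. ?s J (p i)))"
        by (simp add: sum_distrib_left sum_distrib_right mult_ac)
    qed
    also have "\<dots> = (\<Sum>J | card J = k. \<Sum>p | p permutes ?K.
        (\<lambda>f. (\<Prod>i\<in>?K. (ws ! i) $ f i) * ?G f) (restrict (\<lambda>i. ?s J (p i)) ?K))"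
    proof -
      have "Matrix.mat k k (\<lambda>(i, j). g $ ?s I j $ restrict (\<lambda>i. ?s J (p i)) ?K i) =
          Matrix.mat k k (\<lambda>(i, j). g $ ?s I j $ ?s J (p i))" for J p
        by (intro eq_matI) auto
      then show ?thesis by simp
    qed
    also have "\<dots> = (\<Sum>f | f \<in> ?K \<rightarrow>\<^sub>E UNIV \<and> inj_on f ?K. (\<Prod>i\<in>?K. (ws ! i) $ f i) * ?G f)"
      by (rule sum_subsets_permutations[symmetric])
    also have "\<dots> = (\<Sum>f\<in>?K \<rightarrow>\<^sub>E UNIV. (\<Prod>i\<in>?K. (ws ! i) $ f i) * ?G f)"
    proof (rule sum.mono_neutral_left)
      show "finite (?K \<rightarrow>\<^sub>E (UNIV :: 'a set))" by (intro finite_PiE) auto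
      show "\<forall>f\<in>(?K \<rightarrow>\<^sub>E UNIV) - {f. f \<in> ?K \<rightarrow>\<^sub>E UNIV \<and> inj_on f ?K}.
          (\<Prod>i\<in>?K. (ws ! i) $ f i) * ?G f = 0"
      proof
        fix f assume "f \<in> (?K \<rightarrow>\<^sub>E UNIV) - {f. f \<in> ?K \<rightarrow>\<^sub>E (UNIV :: 'a set) \<and> inj_on f ?K}"
        then obtain i j where ij: "i < k" "j < k" "i \<noteq> j" "f i = f j" by (auto simp: inj_on_def)
        have "?G f = 0"
          by (rule Determinant.det_identical_rows[of _ k i j]) (use ij in \<open>auto intro!: eq_vecI\<close>)
        then show "(\<Prod>i\<in>?K. (ws ! i) $ f i) * ?G f = 0" by simp
      qed
    qed auto
    also have "\<dots> = (\<Sum>f\<in>?K \<rightarrow>\<^sub>E UNIV. \<Sum>p | p permutes ?K.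
        signof p * (\<Prod>i\<in>?K. g $ ?s I (p i) $ f i * (ws ! i) $ f i))"
    proof (rule sum.cong[OF refl])
      fix f :: "nat \<Rightarrow> 'a"
      have "?G f = (\<Sum>p | p permutes ?K. signof p * (\<Prod>i\<in>?K. g $ ?s I (p i) $ f i))"
        by (rule det_mat_eq)
      then show "(\<Prod>i\<in>?K. (ws ! i) $ f i) * ?G f = (\<Sum>p | p permutes ?K.
          signof p * (\<Prod>i\<in>?K. g $ ?s I (p i) $ f i * (ws ! i) $ f i))"
        by (simp add: sum_distrib_left prod.distrib mult_ac)
    qed
    also have "\<dots> = (\<Sum>p | p permutes ?K. signof p *
        (\<Prod>i\<in>?K. \<Sum>j\<in>UNIV. g $ ?s I (p i) $ j * (ws ! i) $ j))"
      by (subst sum.swap) (simp add: prod_sum_PiE sum_distrib_left)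
    also have "\<dots> = Determinant.det (Matrix.mat k k (\<lambda>(i, j). (map (\<lambda>w. g *v w) ws ! i) $ ?s I j))"
      unfolding det_mat_eq
    proof (intro sum.cong[OF refl] arg_cong2[of _ _ _ _ "(*)"] prod.cong[OF refl])
      fix p i assume "i \<in> ?K"
      then show "(\<Sum>j\<in>UNIV. g $ ?s I (p i) $ j * (ws ! i) $ j) =
          (map (\<lambda>w. g *v w) ws ! i) $ ?s I (p i)"
        by (simp add: k_def matrix_vector_mult_def)
    qed simp
    also have "\<dots> = wedge (map (\<lambda>w. g *v w) ws) $ I"
      using True by (simp add: wedge_def k_def)
    finally show ?thesis .
  qed
qed

definition basis_list :: "'a::real_vector set \<Rightarrow> 'a list \<Rightarrow> bool" where
  "basis_list W ws \<longleftrightarrow> distinct ws \<and> independent (set ws) \<and> span (set ws) = W"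

subsection \<open>Decomposition into eigenvectors\<close>

text \<open>For \<open>v\<close> in a subspace \<open>V\<close> on which \<open>T\<close> acts diagonalizably, \<open>eigen_components V T v r\<close> is
  the component of \<open>v\<close> in the eigenspace of \<open>T\<close> for \<open>r\<close> (and 0 if \<open>r\<close> is not an eigenvalue).\<close>

definition eigen_components :: "'a::real_vector set \<Rightarrow> ('a \<Rightarrow> 'a) \<Rightarrow> 'a \<Rightarrow> real \<Rightarrow> 'a" where
  "eigen_components V T v = (THE c.
     finite {r. c r \<noteq> 0} \<and>
     (\<forall>r. c r \<in> V \<and> T (c r) = r *\<^sub>R c r) \<and>
     v = (\<Sum>r | c r \<noteq> 0. c r))"

lemma eigenvectors_sum_eq_0:
  assumes "linear T" "finite A" "\<And>r. r \<in> A \<Longrightarrow> T (c r) = r *\<^sub>R c r" "(\<Sum>r\<in>A. c r) = 0" "r \<in> A"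
  shows "c r = 0"
  using assms(2-5)
proof (induction A arbitrary: c r rule: finite_induct)
  case (insert a A)
  have "(\<Sum>r\<in>A. (r - a) *\<^sub>R c r) = T (\<Sum>r\<in>insert a A. c r) - a *\<^sub>R (\<Sum>r\<in>insert a A. c r)"
    using insert.hyps insert.prems(1)
    by (simp add: linear_sum[OF assms(1)] linear_add[OF assms(1)] scaleR_sum_right sum_subtractf
        algebra_simps)
  also have "\<dots> = 0" using insert.prems(2) linear_0[OF assms(1)] by simp
  finally have "(\<Sum>r\<in>A. (r - a) *\<^sub>R c r) = 0" .
  moreover have "T ((r - a) *\<^sub>R c r) = r *\<^sub>R ((r - a) *\<^sub>R c r)" if "r \<in> A" for r
    using insert.prems(1) that by (simp add: linear_scale[OF assms(1)])
  ultimately have "(r - a) *\<^sub>R c r = 0" if "r \<in> A" for r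
    using insert.IH[of "\<lambda>r. (r - a) *\<^sub>R c r"] that by blast
  then have A: "c r = 0" if "r \<in> A" for r using that insert.hyps by auto
  then have "c a = 0" using insert.prems(2) insert.hyps by simp
  with A insert.prems(3) show ?case by auto
qed simp

lemma eigen_components_eqI:
  assumes "linear T" and fin: "finite {r. c r \<noteq> 0}"
    and c: "\<And>r. c r \<in> V" "\<And>r. T (c r) = r *\<^sub>R c r" and v: "v = (\<Sum>r | c r \<noteq> 0. c r)"
  shows "eigen_components V T v = c"
  unfolding eigen_components_def
proof (rule the_equality)
  fix b assume b: "finite {r. b r \<noteq> 0} \<and> (\<forall>r. b r \<in> V \<and> T (b r) = r *\<^sub>R b r) \<and>
    v = (\<Sum>r | b r \<noteq> 0. b r)"
  let ?A = "{r. b r \<noteq> 0} \<union> {r. c r \<noteq> 0}"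
  have A: "finite ?A" using b fin by simp
  have "(\<Sum>r | b r \<noteq> 0. b r) = (\<Sum>r\<in>?A. b r)" "(\<Sum>r | c r \<noteq> 0. c r) = (\<Sum>r\<in>?A. c r)"
    using A by (auto intro!: sum.mono_neutral_left)
  then have "(\<Sum>r\<in>?A. b r - c r) = 0" using b v by (simp add: sum_subtractf)
  moreover have "T (b r - c r) = r *\<^sub>R (b r - c r)" for r
    using b c by (simp add: linear_diff[OF assms(1)] scaleR_diff_right)
  ultimately have "b r - c r = 0" if "r \<in> ?A" for r
    using eigenvectors_sum_eq_0[OF assms(1) A, of "\<lambda>r. b r - c r"] that by blast
  then have "b r = c r" for r by (cases "r \<in> ?A") auto
  then show "b = c" by (rule ext)
qed (use assms in auto)

definition largest_eigenvalue :: "'a::real_vector set \<Rightarrow> ('a \<Rightarrow> 'a) \<Rightarrow> 'a \<Rightarrow> real" where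
  "largest_eigenvalue V T v = Max {r. eigen_components V T v r \<noteq> 0}"

end

theory Submission
  imports Defs
begin

text \<open>For each fixed weight vector, lattice and \<open>k\<close> the two hypotheses say the same: the coordinates of
  \<open>v\<^sub>W\<close> are the maximal minors of a basis matrix of \<open>W\<close>, the minor at \<open>I\<close> is nonzero exactly when \<open>\<pi>\<^sub>I\<close>
  maps \<open>W\<close> onto \<open>\<real>\<^sup>I\<close>, and the standard basis vector at \<open>I\<close> is an eigenvector of the flow at time 1
  with eigenvalue \<open>exp \<mu>\<^sub>I\<close>.\<close>

text \<open>For \<open>I = J\<close> the minor is that of a diagonal matrix; for \<open>I\<close>
  and \<open>J\<close> distinct of equal size one of its rows vanishes. Taking \<open>c\<close> to
  be the diagonal of the flow gives its eigenvectors, and \<open>c = 1\<close> shows that a wedge of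
  axes is a standard basis vector.\<close>

lemma wedge_scaled_axes:
  "wedge (map (\<lambda>j. c j *\<^sub>R axis j 1) (sorted_list_of_set J)) $ I =
    (if I = J then \<Prod>j\<in>J. c j else 0)"
proof (cases "card I = card J")
  case False
  then show ?thesis by (auto simp: wedge_def)
next
  case True
  define k where "k = card J"
  define s where "s = sorted_list_of_set I"
  define s' where "s' = sorted_list_of_set J"
  have [simp]: "length s = k" "length s' = k" "card I = k"
    using True by (simp_all add: s_def s'_def k_def)
  define A where "A = Matrix.mat k k (\<lambda>(i, j). if s ! j = s' ! i then c (s' ! i) else (0 :: real))"
  have A: "A \<in> carrier_mat k k" by (simp add: A_def)
  have "Matrix.mat k k (\<lambda>(i, j). (map (\<lambda>j. c j *\<^sub>R axis j 1) s' ! i) $ (s ! j)) = A"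
    unfolding A_def by (intro eq_matI) (auto simp: axis_def)
  then have w: "wedge (map (\<lambda>j. c j *\<^sub>R axis j 1) s') $ I = Determinant.det A"
    by (simp add: wedge_def flip: s_def)
  have d: "Determinant.det A = (if I = J then \<Prod>j\<in>J. c j else 0)"
  proof (cases "I = J")
    case eq: True
    then have ss: "s = s'" by (simp add: s_def s'_def)
    have dist: "distinct s'" by (simp add: s'_def)
    have "upper_triangular A"
      using dist by (auto simp: upper_triangular_def A_def ss nth_eq_iff_index_eq)
    then have "Determinant.det A = prod_list (diag_mat A)"
      using A by (rule det_upper_triangular)
    also have "diag_mat A = map c s'"
      by (rule nth_equalityI) (auto simp: diag_mat_def A_def ss)
    also have "prod_list (map c s') = (\<Prod>j\<in>J. c j)"
      using prod.distinct_set_conv_list[OF dist, of c] by (simp add: s'_def)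
    finally show ?thesis using eq by simp
  next
    case False
    \<comment> \<open>Some \<open>x\<close> in \<open>J\<close> lies outside \<open>I\<close>, so no
      column index matches it and the row of \<open>x\<close> is zero.\<close>
    then have "\<not> J \<subseteq> I" using True card_subset_eq[of I J] by auto
    then obtain x where x: "x \<in> J" "x \<notin> I" by blast
    then obtain i where i: "i < k" "s' ! i = x"
      by (metis \<open>length s' = k\<close> finite in_set_conv_nth s'_def set_sorted_list_of_set)
    have nz: "s ! j \<noteq> x" if "j < k" for j
      using that x by (metis \<open>length s = k\<close> finite nth_mem s_def set_sorted_list_of_set)
    have "A $$ (i, j) = 0" if "j < k" for j
      using i nz that by (simp add: A_def)
    then have "Determinant.det A = 0"
      unfolding laplace_expansion_row[OF A i(1)] by (intro sum.neutral) auto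
    then show ?thesis using False by simp
  qed
  show ?thesis using w d by (simp add: s'_def)
qed

lemma linear_ext_map: "linear (ext_map g)"
  by (intro linearI)
    (simp_all add: ext_map_def scaleR_left_distrib sum.distrib scaleR_sum_right)

lemma flow_axis:
  "flow m \<omega> t *v axis j 1 = exp ((if pos j \<le> m then \<omega> $ j else - \<omega> $ j) * t) *\<^sub>R axis j 1"
proof (rule vec_eq_iff[THEN iffD2], rule allI)
  fix i
  have "(flow m \<omega> t *v axis j 1) $ i = flow m \<omega> t $ i $ j"
    by (simp add: matrix_vector_mult_basis column_def)
  then show "(flow m \<omega> t *v axis j 1) $ i =
      (exp ((if pos j \<le> m then \<omega> $ j else - \<omega> $ j) * t) *\<^sub>R axis j 1) $ i"
    by (auto simp: flow_def axis_def)
qed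

lemma mu_eq_sum: "mu m \<omega> I = (\<Sum>i\<in>I. if pos i \<le> m then \<omega> $ i else - \<omega> $ i)"
  by (simp add: mu_def sum.If_cases sum_negf Int_def not_le)

text \<open>By \<open>flow_axis\<close> every summand of \<open>ext_map\<close> is a wedge of scaled
  axes, so only \<open>J = I\<close> contributes, and the product of its exponentials is the
  exponential of \<open>mu\<close>.\<close>

lemma ext_map_flow: "ext_map (flow m \<omega> t) v $ I = exp (mu m \<omega> I * t) * v $ I"
  by (simp add: ext_map_def flow_axis wedge_scaled_axes mu_eq_sum exp_sum sum_distrib_right
      if_distrib[of "(*) _"] cong: if_cong)

text \<open>Different sets may share a value of \<open>mu\<close>, so the component for
  \<open>r\<close> collects all coordinates \<open>I\<close> with
  \<open>exp (mu m \<omega> I) = r\<close>.\<close>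

lemma eigen_components_flow:
  assumes "v \<in> ext_power k"
  shows "eigen_components (ext_power k) (ext_map (flow m \<omega> 1)) v =
    (\<lambda>r. \<chi> I. if exp (mu m \<omega> I) = r then v $ I else 0)" (is "_ = ?c")
proof (rule eigen_components_eqI)
  let ?E = "range (\<lambda>I. exp (mu m \<omega> I))"
  have sub: "{r. ?c r \<noteq> 0} \<subseteq> ?E" by (auto simp: vec_eq_iff)
  then show "finite {r. ?c r \<noteq> 0}" by (rule finite_subset) simp
  show "?c r \<in> ext_power k" for r using assms by (auto simp: ext_power_def)
  show "ext_map (flow m \<omega> 1) (?c r) = r *\<^sub>R ?c r" for r
    by (auto simp: vec_eq_iff ext_map_flow)
  \<comment> \<open>Over all of \<open>?E\<close> each coordinate \<open>I\<close> is picked up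
    exactly once, at \<open>r = exp (mu m \<omega> I)\<close>.\<close>
  have "(\<Sum>r | ?c r \<noteq> 0. ?c r) = (\<Sum>r\<in>?E. ?c r)"
    using sub by (intro sum.mono_neutral_left) auto
  also have "\<dots> = v" by (auto simp: vec_eq_iff)
  finally show "v = (\<Sum>r | ?c r \<noteq> 0. ?c r)" ..
qed (rule linear_ext_map)

text \<open>A maximum over a finite nonempty set exceeds 1 iff some element does, and
  \<open>exp x > 1\<close> iff \<open>x > 0\<close>. That \<open>v\<close> is nonzero makes the set
  nonempty.\<close>

lemma largest_eigenvalue_flow_gt_1_iff:
  assumes "v \<in> ext_power k" "v \<noteq> 0"
  shows "largest_eigenvalue (ext_power k) (ext_map (flow m \<omega> 1)) v > 1 \<longleftrightarrow>
    (\<exists>I. v $ I \<noteq> 0 \<and> mu m \<omega> I > 0)"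
proof -
  have "{r. eigen_components (ext_power k) (ext_map (flow m \<omega> 1)) v r \<noteq> 0} =
      (\<lambda>I. exp (mu m \<omega> I)) ` {I. v $ I \<noteq> 0}"
    unfolding eigen_components_flow[OF assms(1)] by (auto simp: vec_eq_iff)
  moreover have "{I. v $ I \<noteq> 0} \<noteq> {}" using assms(2) by (auto simp: vec_eq_iff)
  ultimately show ?thesis by (auto simp: largest_eigenvalue_def Max_gr_iff)
qed

lemma wedge_in_ext_power: "wedge ws \<in> ext_power (length ws)"
  by (auto simp: ext_power_def wedge_def)

text \<open>A linear map sends the independent vectors to distinct axes. By
  \<open>ext_map_wedge\<close> its action takes their wedge to a standard basis vector, which is
  nonzero.\<close>

lemma wedge_nonzero:
  fixes ws :: "(real ^ 'd::{finite,linorder}) list"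
  assumes "distinct ws" "independent (set ws)"
  shows "wedge ws \<noteq> 0"
proof
  assume 0: "wedge ws = 0"
  have "length ws \<le> CARD('d)"
    using independent_bound[OF assms(2)] distinct_card[OF assms(1)] by simp
  then obtain I :: "'d set" where I: "card I = length ws"
    using obtain_subset_with_card_n by metis
  define s where "s = sorted_list_of_set I"
  have len: "length s = length ws" using I by (simp add: s_def)
  \<comment> \<open>\<open>h\<close> sends the vector at position \<open>i\<close> of
    \<open>ws\<close> to the axis of the \<open>i\<close>-th smallest element of \<open>I\<close>;
    off \<open>ws\<close> its value is irrelevant.\<close>
  define h where "h x = axis (the (map_of (zip ws s) x)) (1 :: real)" for x
  have "\<exists>f. linear f \<and> (\<forall>x\<in>set ws. f x = h x)"
    by (rule linear_independent_extend[OF assms(2)])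
  then obtain f where f: "linear f" "\<And>x. x \<in> set ws \<Longrightarrow> f x = h x" by blast
  have "map f ws = map (\<lambda>j. 1 *\<^sub>R axis j 1) s"
    using len assms(1) by (intro nth_equalityI) (auto simp: f(2) h_def map_of_zip_nth)
  moreover have "ext_map (matrix f) (wedge ws) = wedge (map f ws)"
    unfolding ext_map_wedge using f(1) by (simp add: matrix_works)
  ultimately have "wedge (map (\<lambda>j. 1 *\<^sub>R axis j 1) s) = 0"
    using 0 linear_0[OF linear_ext_map] by metis
  then have "wedge (map (\<lambda>j. 1 *\<^sub>R axis j 1) s) $ I = 0" by (metis zero_index)
  then show False unfolding s_def wedge_scaled_axes by simp
qed

lemma span_set_expansion:
  assumes "distinct ws" "x \<in> span (set ws)"
  obtains c where "x = (\<Sum>i<length ws. c i *\<^sub>R ws ! i)"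
proof -
  obtain u where u: "x = (\<Sum>v\<in>set ws. u v *\<^sub>R v)"
    using assms(2) by (auto simp: span_finite)
  also have "\<dots> = (\<Sum>i<length ws. u (ws ! i) *\<^sub>R ws ! i)"
    using assms(1) by (intro sum.reindex_bij_betw[symmetric] bij_betw_nth) auto
  finally show thesis by (rule that)
qed

text \<open>The coordinate is the determinant of the matrix \<open>A\<close> whose rows are the
  \<open>I\<close>-coordinates of \<open>ws\<close>. The projection is onto iff every axis in
  \<open>I\<close> comes from a combination of \<open>ws\<close>, that is, iff \<open>A\<close> has
  a left inverse.\<close>

lemma wedge_component_nonzero_iff:
  fixes ws :: "(real ^ 'd::{finite,linorder}) list"
  assumes "distinct ws" "card I = length ws"
  shows "wedge ws $ I \<noteq> 0 \<longleftrightarrow>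
    orth_proj (coord_subspace I) ` span (set ws) = coord_subspace I"
proof -
  define k where "k = length ws"
  define s where "s = sorted_list_of_set I"
  have len: "length s = k" using assms(2) by (simp add: s_def k_def)
  have s: "distinct s" "set s = I" by (simp_all add: s_def)
  define P where "P = (orth_proj (coord_subspace I) :: real ^ 'd::{finite,linorder} \<Rightarrow> _)"
  have P: "P x = (\<chi> i. if i \<in> I then x $ i else 0)" for x
    unfolding P_def by (rule orth_proj_coord_subspace)
  have linP: "linear P" by (intro linearI) (auto simp: P vec_eq_iff)
  have P_axes: "P x = (\<Sum>i\<in>I. x $ i *\<^sub>R axis i 1)" for x
    by (auto simp: P vec_eq_iff axis_def if_distrib[of "(*) _"] cong: if_cong)
  have P_in: "P x \<in> coord_subspace I" for x
    unfolding P_axes coord_subspace_def by (intro span_sum span_scale span_base) auto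
  define A where "A = Matrix.mat k k (\<lambda>(i, j). (ws ! i) $ (s ! j))"
  have A: "A \<in> carrier_mat k k" by (simp add: A_def)
  have w: "wedge ws $ I = Determinant.det A"
    unfolding wedge_def A_def k_def s_def using assms(2) by simp
  \<comment> \<open>Row \<open>j\<close> of \<open>C\<close> holds the coefficients of a combination
    of \<open>ws\<close>; row \<open>j\<close> of \<open>C * A\<close> holds its
    \<open>I\<close>-coordinates.\<close>
  have entry: "(\<Sum>i<k. C $$ (j, i) *\<^sub>R ws ! i) $ (s ! l) = (C * A) $$ (j, l)"
    if "C \<in> carrier_mat k k" "j < k" "l < k" for C j l
    using that by (auto simp: A_def scalar_prod_def lessThan_atLeast0 intro!: sum.cong)
  have onto: "P ` span (set ws) = coord_subspace I" if det: "Determinant.det A \<noteq> 0"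
  proof
    show "P ` span (set ws) \<subseteq> coord_subspace I" using P_in by auto
    have "axis i 1 \<in> P ` span (set ws)" if i: "i \<in> I" for i
    proof -
      obtain j where j: "j < k" "i = s ! j" using i s(2) len by (metis in_set_conv_nth)
      \<comment> \<open>The adjugate divided by the determinant is the inverse of \<open>A\<close>,
        so its row \<open>j\<close> gives the combination \<open>x\<close> that projects to the axis
        at \<open>s ! j\<close>.\<close>
      define C where "C = adj_mat A"
      have C: "C \<in> carrier_mat k k" "C * A = Determinant.det A \<cdot>\<^sub>m 1\<^sub>m k"
        unfolding C_def using adj_mat[OF A] by auto
      define x where "x = (1 / Determinant.det A) *\<^sub>R (\<Sum>i<k. C $$ (j, i) *\<^sub>R ws ! i)"
      have "x \<in> span (set ws)" unfolding x_def
        by (intro span_scale span_sum span_base) (simp add: k_def)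
      moreover have "P x = axis i 1"
      proof -
        have "x $ (s ! l) = axis i 1 $ (s ! l)" if "l < k" for l
          using that j det s(1) len entry[OF C(1) j(1) that]
          by (simp add: x_def C(2) axis_def nth_eq_iff_index_eq)
        then have "x $ l = axis i 1 $ l" if "l \<in> I" for l
          using that s(2) len by (metis in_set_conv_nth)
        then show ?thesis using i by (auto simp: P vec_eq_iff axis_def)
      qed
      ultimately show ?thesis by (metis imageI)
    qed
    then show "coord_subspace I \<subseteq> P ` span (set ws)"
      unfolding coord_subspace_def
      by (intro span_minimal linear_subspace_image linP subspace_span) auto
  qed
  have det: "Determinant.det A \<noteq> 0" if onto: "P ` span (set ws) = coord_subspace I"
  proof -
    \<comment> \<open>A preimage of each axis, expanded in \<open>ws\<close>, supplies one row of
      the left inverse.\<close>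
    have "\<exists>c. \<forall>l<k. (\<Sum>i<k. c i *\<^sub>R ws ! i) $ (s ! l) = axis (s ! j) 1 $ (s ! l)" if "j < k" for j
    proof -
      have "s ! j \<in> I" using that len s(2) nth_mem by metis
      then have "axis (s ! j) 1 \<in> P ` span (set ws)"
        unfolding onto coord_subspace_def by (intro span_base) auto
      then obtain x where x: "x \<in> span (set ws)" "P x = axis (s ! j) 1" by auto
      obtain c where c: "x = (\<Sum>i<k. c i *\<^sub>R ws ! i)"
        unfolding k_def by (rule span_set_expansion[OF assms(1) x(1)])
      have "x $ (s ! l) = axis (s ! j) 1 $ (s ! l)" if "l < k" for l
      proof -
        have "s ! l \<in> I" using that len s(2) nth_mem by metis
        then show ?thesis unfolding x(2)[symmetric] P by simp
      qed
      then show ?thesis unfolding c by blast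
    qed
    then have "\<exists>c. \<forall>j\<in>{..<k}. \<forall>l<k.
        (\<Sum>i<k. c j i *\<^sub>R ws ! i) $ (s ! l) = axis (s ! j) 1 $ (s ! l)"
      by (intro bchoice) blast
    then obtain c where c: "(\<Sum>i<k. c j i *\<^sub>R ws ! i) $ (s ! l) = axis (s ! j) 1 $ (s ! l)"
      if "j < k" "l < k" for j l
      by blast
    define C where "C = Matrix.mat k k (\<lambda>(i, j). c i j)"
    have C: "C \<in> carrier_mat k k" by (simp add: C_def)
    have "(C * A) $$ (j, l) = 1\<^sub>m k $$ (j, l)" if "j < k" "l < k" for j l
    proof -
      have "(C * A) $$ (j, l) = (\<Sum>i<k. c j i *\<^sub>R ws ! i) $ (s ! l)"
        unfolding entry[OF C that, symmetric] using that by (simp add: C_def)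
      also have "\<dots> = 1\<^sub>m k $$ (j, l)"
        unfolding c[OF that] using that s(1) len by (auto simp: axis_def nth_eq_iff_index_eq)
      finally show ?thesis .
    qed
    then have "C * A = 1\<^sub>m k" using A C by (intro eq_matI) auto
    then have "Determinant.det C * Determinant.det A = 1"
      using Determinant.det_mult[OF C A] by simp
    then show ?thesis by auto
  qed
  show ?thesis unfolding w P_def[symmetric] using onto det by (intro iffI)
qed

text \<open>The right side does not mention \<open>ws\<close>, so the eigenvalue condition is
  independent of the basis chosen for \<open>W\<close>.\<close>

lemma largest_eigenvalue_wedge_gt_1_iff:
  assumes "basis_list W ws" "dim W = k"
  shows "largest_eigenvalue (ext_power k) (ext_map (flow m \<omega> 1)) (wedge ws) > 1 \<longleftrightarrow>
    (\<exists>I. card I = k \<and> mu m \<omega> I > 0 \<and> orth_proj (coord_subspace I) ` W = coord_subspace I)"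
proof -
  have ws: "distinct ws" "independent (set ws)" "span (set ws) = W"
    using assms(1) by (auto simp: basis_list_def)
  have len: "length ws = k"
    using ws assms(2) dim_span_eq_card_independent distinct_card by metis
  have card: "card I = k" if "wedge ws $ I \<noteq> 0" for I
    using that len by (auto simp: wedge_def split: if_splits)
  have "wedge ws \<in> ext_power k" using wedge_in_ext_power[of ws] len by simp
  note eig = largest_eigenvalue_flow_gt_1_iff[OF this wedge_nonzero[OF ws(1,2)]]
  have "wedge ws $ I \<noteq> 0 \<longleftrightarrow>
      card I = k \<and> orth_proj (coord_subspace I) ` W = coord_subspace I" for I
    using card[of I] wedge_component_nonzero_iff[OF ws(1), of I] ws(3) len by auto
  then show ?thesis unfolding eig by auto
qed

text \<open>The eigenvalue hypothesis quantifies over the bases of \<open>W\<close>; the existence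
  of one keeps it from holding vacuously.\<close>

lemma lattice_subspace_basis_list:
  assumes "lattice_subspace \<Lambda> k W"
  obtains ws where "basis_list W ws"
proof -
  have "subspace W" using assms by (auto simp: lattice_subspace_def)
  then obtain B where B: "independent B" "span B = W"
    by (metis basis_exists span_subspace)
  then obtain ws where "set ws = B" "distinct ws"
    using finite_distinct_list independent_imp_finite by metis
  with B show thesis by (intro that) (auto simp: basis_list_def)
qed

theorem proposition1p7:
  fixes m n :: nat
  assumes "CARD('d::{finite,linorder}) \<ge> 2" and "m \<ge> 1" and "n \<ge> 1" and "m + n = CARD('d)"
  shows
    "(\<forall>(\<omega> :: real ^ 'd::{finite,linorder}) k \<Lambda>.
        weight_vector m n \<omega> \<and> k \<in> {1..CARD('d) - 1} \<and> unimodular_lattice \<Lambda> \<longrightarrow>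
        (\<forall>W. lattice_subspace \<Lambda> k W \<longrightarrow>
           (\<exists>I. card I = k \<and> mu m \<omega> I > 0 \<and> orth_proj (coord_subspace I) ` W = coord_subspace I)) \<longrightarrow>
        connected_at m \<omega> \<Lambda> k)
     \<longleftrightarrow>
     (\<forall>(\<omega> :: real ^ 'd::{finite,linorder}) k \<Lambda>.
        weight_vector m n \<omega> \<and> k \<in> {1..CARD('d) - 1} \<and> unimodular_lattice \<Lambda> \<longrightarrow>
        (\<forall>W ws. lattice_subspace \<Lambda> k W \<and> basis_list W ws \<longrightarrow>
           largest_eigenvalue (ext_power k) (ext_map (flow m \<omega> 1)) (wedge ws) > 1) \<longrightarrow>
        connected_at m \<omega> \<Lambda> k)"
proof -
  have "(\<forall>W. lattice_subspace \<Lambda> k W \<longrightarrow>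
      (\<exists>I. card I = k \<and> mu m \<omega> I > 0 \<and> orth_proj (coord_subspace I) ` W = coord_subspace I)) \<longleftrightarrow>
    (\<forall>W ws. lattice_subspace \<Lambda> k W \<and> basis_list W ws \<longrightarrow>
      largest_eigenvalue (ext_power k) (ext_map (flow m \<omega> 1)) (wedge ws) > 1)"
    for \<omega> :: "real ^ 'd::{finite,linorder}" and k \<Lambda>
    using largest_eigenvalue_wedge_gt_1_iff lattice_subspace_basis_list
    unfolding lattice_subspace_def by metis
  then show ?thesis by simp
qed

end
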